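(* Let $\mathcal H$ be a real Hilbert space and let $f\in\Gamma_0(\mathcal H)$ be such that $\operatorname{lev}_{\leq 0}f\neq\varnothing$. If $f$ is Fréchet differentiable on $\operatorname{int}\operatorname{dom}f\cap\{x\in\mathcal H: f(x)>0\}$, then the set-valued operator $G_f$ is continuous at every point of $\operatorname{int}(\operatorname{lev}_{\leq 0}f)\cup(\operatorname{int}\operatorname{dom}f\cap\{x: f(x)>0\})$ and lower semicontinuous at every point of the boundary of $\operatorname{lev}_{\leq 0}f$.
   Context: All topological notions refer to the norm topology. $\Gamma_0(\mathcal H)$ is the set of proper convex lower semicontinuous functions $\mathcal H\to]-\infty,+\infty]$; $\operatorname{dom}f=\{f<+\infty\}$; $\operatorname{lev}_{\leq 0}f=\{x: f(x)\leq 0\}$. $\partial f$ is the convex subdifferential. The subgradient projector $G_f:\mathcal H\to 2^{\mathcal H}$ is $G_fx=\{x\}$ if $f(x)\leq 0$ and $G_fx=\{x-\frac{f(x)}{\|u\|^2}u : u\in\partial f(x)\}$ if $f(x)>0$ (subgradients at points where $f>0$ are nonzero because $\operatorname{lev}_{\leq 0}f\neq\varnothing$). For a set-valued $A:X\to2^Y$ between metric spaces, with $\operatorname{dom}A=\{x:Ax\neq\varnothing\}$, and $x\in\operatorname{dom}A$: $A$ is lower semicontinuous at $x$ if for every sequence $(x_n)$ in $\operatorname{dom}A$ converging to $x$ and every $y\in Ax$ there are $y_n\in Ax_n$ with $y_n\to y$; $A$ is upper semicontinuous at $x$ if for every neighborhood $V$ of $Ax$ there is a neighborhood $W$ of $x$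 with $A(W)=\bigcup_{w\in W}Aw\subset V$; $A$ is continuous at $x$ if it is both. *)

theory Defs
  imports "HOL-Analysis.Analysis"
begin

definition effective_dom :: "('a \<Rightarrow> ereal) \<Rightarrow> 'a set" where
  "effective_dom f = {x. f x < \<infinity>}"

definition lev_le0 :: "('a \<Rightarrow> ereal) \<Rightarrow> 'a set" where
  "lev_le0 f = {x. f x \<le> 0}"

definition proper_fun :: "('a \<Rightarrow> ereal) \<Rightarrow> bool" where
  "proper_fun f \<longleftrightarrow> (\<forall>x. f x \<noteq> -\<infinity>) \<and> effective_dom f \<noteq> {}"

(* Restricting t to the open interval avoids products 0 * \<infinity>; for functions that never take
   the value -\<infinity> no sum \<infinity> - \<infinity> can occur on the right-hand side. *)
definition convex_fun :: "('a::real_vector \<Rightarrow> ereal) \<Rightarrow> bool" where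
  "convex_fun f \<longleftrightarrow>
     (\<forall>x y t. 0 < t \<and> t < 1 \<longrightarrow>
        f ((1 - t) *\<^sub>R x + t *\<^sub>R y) \<le> ereal (1 - t) * f x + ereal t * f y)"

definition lsc_fun :: "('a::topological_space \<Rightarrow> ereal) \<Rightarrow> bool" where
  "lsc_fun f \<longleftrightarrow> (\<forall>x. f x \<le> Liminf (nhds x) f)"

definition Gamma0 :: "('a::real_normed_vector \<Rightarrow> ereal) set" where
  "Gamma0 = {f. proper_fun f \<and> convex_fun f \<and> lsc_fun f}"

(* For proper f this is empty at every x with f x = \<infinity>. *)
definition subdifferential :: "('a::real_inner \<Rightarrow> ereal) \<Rightarrow> 'a \<Rightarrow> 'a set" where
  "subdifferential f x = {u. \<forall>y. f x + ereal ((y - x) \<bullet> u) \<le> f y}"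

(* For proper f, f x is finite wherever the subdifferential is nonempty, so real_of_ereal (f x) is its value. *)
definition subgrad_projector :: "('a::real_inner \<Rightarrow> ereal) \<Rightarrow> 'a \<Rightarrow> 'a set" where
  "subgrad_projector f x =
     (if f x \<le> 0 then {x}
      else {x - (real_of_ereal (f x) / (norm u)\<^sup>2) *\<^sub>R u | u. u \<in> subdifferential f x})"

definition setval_dom :: "('a \<Rightarrow> 'b set) \<Rightarrow> 'a set" where
  "setval_dom A = {x. A x \<noteq> {}}"

definition setval_lsc_at :: "('a::metric_space \<Rightarrow> 'b::metric_space set) \<Rightarrow> 'a \<Rightarrow> bool" where
  "setval_lsc_at A x \<longleftrightarrow>
     x \<in> setval_dom A \<and>
     (\<forall>xs y. (\<forall>n. xs n \<in> setval_dom A) \<and> xs \<longlonglongrightarrow> x \<and> y \<in> A x \<longrightarrow>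
        (\<exists>ys. (\<forall>n. ys n \<in> A (xs n)) \<and> ys \<longlonglongrightarrow> y))"

(* V is a neighborhood of a set S iff S is contained in the interior of V. *)
definition setval_usc_at :: "('a::metric_space \<Rightarrow> 'b::metric_space set) \<Rightarrow> 'a \<Rightarrow> bool" where
  "setval_usc_at A x \<longleftrightarrow>
     x \<in> setval_dom A \<and>
     (\<forall>V. A x \<subseteq> interior V \<longrightarrow> (\<exists>W. x \<in> interior W \<and> (\<Union>w\<in>W. A w) \<subseteq> V))"

definition setval_continuous_at :: "('a::metric_space \<Rightarrow> 'b::metric_space set) \<Rightarrow> 'a \<Rightarrow> bool" where
  "setval_continuous_at A x \<longleftrightarrow> setval_lsc_at A x \<and> setval_usc_at A x"

end

(* If f x \<le> 0, every p in G y satisfies dist p x \<le> dist y x, because p is y itself or the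
   projection of y onto a half-space that contains the level set; hence G is continuous at x.
   If f x > 0, Frechet differentiability at x forces all subgradients at points near x to be
   norm-close to the gradient u at x, and u is nonzero because f has a nonpositive value. *)
theory Submission
  imports Defs
begin

section \<open>Riesz representation of bounded linear functionals\<close>

text \<open>The representing vector minimizes \<open>(norm v)\<^sup>2 - 2 * \<phi> v\<close>; by the parallelogram law
  minimizing sequences are Cauchy.\<close>

lemma riesz_representation:
  fixes \<phi> :: "'a::{real_inner,complete_space} \<Rightarrow> real"
  assumes "bounded_linear \<phi>"
  obtains u where "\<And>h. \<phi> h = h \<bullet> u"
proof -
  interpret bounded_linear \<phi> by fact
  define J where "J v = (norm v)\<^sup>2 - 2 * \<phi> v" for v
  obtain K where K: "\<And>v. norm (\<phi> v) \<le> norm v * K"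
    using bounded by blast
  have "- K\<^sup>2 \<le> J v" for v
  proof -
    have "0 \<le> (norm v - K)\<^sup>2" by simp
    moreover have "\<phi> v \<le> norm v * K" using K[of v] by simp
    ultimately show ?thesis unfolding J_def by (simp add: power2_diff)
  qed
  then have bdd: "bdd_below (range J)" by (auto intro!: bdd_belowI)
  define m where "m = Inf (range J)"
  have m_le: "m \<le> J v" for v
    unfolding m_def using bdd by (simp add: cInf_lower)
  have "\<exists>v. J v < m + 1 / real (Suc n)" for n
    using cInf_lessD[of "range J" "m + 1 / real (Suc n)"] unfolding m_def by auto
  then obtain v where v: "\<And>n. J (v n) < m + 1 / real (Suc n)"
    by metis
  \<comment> \<open>By the parallelogram law the left side equals
    \<open>2 * J a + 2 * J b - 4 * J c\<close> with \<open>c\<close> the midpoint of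
    \<open>a\<close> and \<open>b\<close>, and \<open>J c\<close> is at least
    \<open>m\<close>.\<close>
  have par: "(norm (a - b))\<^sup>2 \<le> 2 * (J a - m) + 2 * (J b - m)" for a b
  proof -
    have "J ((1/2) *\<^sub>R (a + b)) = (norm (a + b))\<^sup>2 / 4 - \<phi> a - \<phi> b"
      unfolding J_def by (simp add: scaleR add power_mult_distrib power_divide add_divide_distrib
          del: scaleR_add_right)
    moreover have "(norm (a - b))\<^sup>2 + (norm (a + b))\<^sup>2 = 2 * (norm a)\<^sup>2 + 2 * (norm b)\<^sup>2"
      by (simp add: power2_norm_eq_inner algebra_simps inner_commute)
    ultimately show ?thesis
      using m_le[of "(1/2) *\<^sub>R (a + b)"] unfolding J_def by simp
  qed
  have "Cauchy v"
  proof (rule metric_CauchyI)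
    fix e :: real assume "e > 0"
    \<comment> \<open>In \<open>par\<close> both excesses over \<open>m\<close> are doubled, so a
      bound of one quarter of the squared tolerance on each suffices.\<close>
    then obtain N where N: "1 / real (Suc N) < e\<^sup>2 / 4"
      using reals_Archimedean[of "e\<^sup>2 / 4"] by (auto simp: inverse_eq_divide)
    have small: "J (v k) - m < e\<^sup>2 / 4" if "k \<ge> N" for k
    proof -
      have "1 / real (Suc k) \<le> 1 / real (Suc N)" using that by (simp add: frac_le)
      then show ?thesis using v[of k] N by linarith
    qed
    have "dist (v i) (v j) < e" if "i \<ge> N" "j \<ge> N" for i j
    proof -
      have "(norm (v i - v j))\<^sup>2 < e\<^sup>2"
        using par[of "v i" "v j"] small[OF that(1)] small[OF that(2)] by argo
      then show ?thesis
        using \<open>e > 0\<close> by (simp add: dist_norm power2_less_imp_less)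
    qed
    then show "\<exists>N. \<forall>i\<ge>N. \<forall>j\<ge>N. dist (v i) (v j) < e" by blast
  qed
  then obtain u where u: "v \<longlonglongrightarrow> u"
    using Cauchy_convergent_iff convergent_def by blast
  have "(\<lambda>n. J (v n)) \<longlonglongrightarrow> J u"
    unfolding J_def by (intro tendsto_intros tendsto u)
  moreover have "(\<lambda>n. m + 1 / real (Suc n)) \<longlonglongrightarrow> m + 0"
    using LIMSEQ_inverse_real_of_nat by (intro tendsto_intros) (simp add: inverse_eq_divide)
  ultimately have "J u \<le> m + 0"
    using v by (intro LIMSEQ_le) (auto intro: less_imp_le)
  then have min: "J u \<le> J w" for w using m_le[of w] by simp
  have "\<phi> h = h \<bullet> u" for h
  proof (cases "h = 0")
    case False
    define c where "c = h \<bullet> u - \<phi> h"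
    \<comment> \<open>This \<open>t\<close> minimizes the quadratic
      \<open>J (u + t *\<^sub>R h)\<close>. The resulting change in \<open>J\<close> is
      \<open>- (c\<^sup>2 / (norm h)\<^sup>2)\<close>, which minimality of \<open>u\<close> allows
      only for \<open>c = 0\<close>.\<close>
    define t where "t = - c / (norm h)\<^sup>2"
    have "J (u + t *\<^sub>R h) = J u + t\<^sup>2 * (norm h)\<^sup>2 + 2 * t * c"
      unfolding J_def c_def power2_norm_eq_inner
      by (simp add: add scaleR inner_commute algebra_simps power2_eq_square)
    then have "0 \<le> t\<^sup>2 * (norm h)\<^sup>2 + 2 * t * c" using min[of "u + t *\<^sub>R h"] by simp
    also have "\<dots> = - (c\<^sup>2 / (norm h)\<^sup>2)"
      using False unfolding t_def by (simp add: field_simps power2_eq_square)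
    finally have "c = 0" using False by (simp add: divide_le_0_iff)
    then show ?thesis unfolding c_def by simp
  qed (simp add: zero)
  then show ?thesis by (rule that)
qed

section \<open>Closedness of the level set and a criterion for set-valued continuity\<close>

lemma closed_lev_le0:
  assumes "lsc_fun f"
  shows "closed (lev_le0 f)"
proof -
  have "\<forall>\<^sub>F y in nhds x. f y > 0" if "f x > 0" for x
  proof -
    have "0 < Liminf (nhds x) f" using assms that unfolding lsc_fun_def by (meson less_le_trans)
    then show ?thesis by (rule less_LiminfD)
  qed
  then have "open (- lev_le0 f)"
    by (subst open_subopen) (force simp: lev_le0_def not_le eventually_nhds)
  then show ?thesis by (simp add: closed_def)
qed

text \<open>With a single value at \<open>x\<close>, every selection along a sequence tending to
  \<open>x\<close> is forced to converge to \<open>p\<close>, which gives lower semicontinuity; a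
  ball around \<open>p\<close> inside \<open>V\<close> gives upper semicontinuity. Empty values near
  \<open>x\<close> do no harm, since only sequences in the domain are tested.\<close>

lemma setval_continuous_at_singletonI:
  assumes Ax: "A x = {p}"
    and ev: "\<And>e. e > 0 \<Longrightarrow> \<forall>\<^sub>F y in nhds x. A y \<subseteq> ball p e"
  shows "setval_continuous_at A x"
  unfolding setval_continuous_at_def
proof
  have dom: "x \<in> setval_dom A" using Ax by (simp add: setval_dom_def)
  show "setval_lsc_at A x"
    unfolding setval_lsc_at_def
  proof (intro conjI allI impI)
    fix xs y
    assume H: "(\<forall>n. xs n \<in> setval_dom A) \<and> xs \<longlonglongrightarrow> x \<and> y \<in> A x"
    then obtain ys where ys: "\<And>n. ys n \<in> A (xs n)"
      using choice[of "\<lambda>n y. y \<in> A (xs n)"] by (auto simp: setval_dom_def ex_in_conv)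
    have "ys \<longlonglongrightarrow> p"
    proof (rule tendstoI)
      fix e :: real assume "e > 0"
      have "\<forall>\<^sub>F n in sequentially. A (xs n) \<subseteq> ball p e"
        using ev[OF \<open>e > 0\<close>] H by (auto simp: filterlim_iff)
      then show "\<forall>\<^sub>F n in sequentially. dist (ys n) p < e"
        by (rule eventually_mono) (use ys in \<open>force simp: dist_commute\<close>)
    qed
    then show "\<exists>ys. (\<forall>n. ys n \<in> A (xs n)) \<and> ys \<longlonglongrightarrow> y"
      using ys H Ax by auto
  qed (rule dom)
  show "setval_usc_at A x"
    unfolding setval_usc_at_def
  proof (intro conjI allI impI)
    fix V assume "A x \<subseteq> interior V"
    then obtain e where e: "e > 0" "ball p e \<subseteq> V"
      using Ax by (auto simp: mem_interior)
    from ev[OF e(1)] obtain W where "open W" "x \<in> W" "\<And>w. w \<in> W \<Longrightarrow> A w \<subseteq> ball p e"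
      unfolding eventually_nhds by blast
    then show "\<exists>W. x \<in> interior W \<and> (\<Union>w\<in>W. A w) \<subseteq> V"
      using e(2) by (intro exI[of _ W]) (auto simp: interior_open)
  qed (rule dom)
qed

section \<open>The projector at points of the level set\<close>

lemma subdifferential_finite:
  assumes "proper_fun f" and "u \<in> subdifferential f x"
  shows "f x = ereal (real_of_ereal (f x))"
proof -
  obtain z where "f z < \<infinity>" using assms(1) by (auto simp: proper_fun_def effective_dom_def)
  moreover have "f x + ereal ((z - x) \<bullet> u) \<le> f z"
    using assms(2) by (simp add: subdifferential_def)
  ultimately have "f x \<noteq> \<infinity>" by auto
  then show ?thesis using assms(1) by (cases "f x") (auto simp: proper_fun_def)
qed

text \<open>The subgradient inequality from \<open>y\<close> to \<open>x\<close> gives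
  \<open>(y - x) \<bullet> u \<ge> r\<close> with \<open>r\<close> the value of \<open>f\<close> at
  \<open>y\<close>. In the expansion of the squared distance the cross term therefore outweighs the
  term \<open>s * r\<close> that the step adds.\<close>

lemma subgrad_projector_dist_le:
  fixes f :: "'a::real_inner \<Rightarrow> ereal"
  assumes "proper_fun f" and x: "f x \<le> 0" and p: "p \<in> subgrad_projector f y"
  shows "dist p x \<le> dist y x"
proof (cases "f y \<le> 0")
  case True
  then show ?thesis using p by (simp add: subgrad_projector_def)
next
  case False
  then obtain u where u: "u \<in> subdifferential f y"
    and p_eq: "p = y - (real_of_ereal (f y) / (norm u)\<^sup>2) *\<^sub>R u"
    using p by (auto simp: subgrad_projector_def)
  define r where "r = real_of_ereal (f y)"
  have fy: "f y = ereal r"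
    using subdifferential_finite[OF assms(1) u] by (simp add: r_def)
  have r: "r > 0" using False fy by simp
  have "ereal r + ereal ((x - y) \<bullet> u) \<le> 0"
    using u x fy unfolding subdifferential_def by (metis (mono_tags, lifting) mem_Collect_eq order_trans)
  then have le: "r \<le> (y - x) \<bullet> u" by (simp add: zero_ereal_def inner_diff_left)
  then have "u \<noteq> 0" using r by auto
  define s where "s = r / (norm u)\<^sup>2"
  have s: "s \<ge> 0" "s * (norm u)\<^sup>2 = r" using r \<open>u \<noteq> 0\<close> by (simp_all add: s_def)
  have "(norm (p - x))\<^sup>2 = (norm ((y - x) - s *\<^sub>R u))\<^sup>2"
    by (simp add: p_eq s_def r_def algebra_simps)
  also have "\<dots> = (norm (y - x))\<^sup>2 - 2 * s * ((y - x) \<bullet> u) + s * (s * (norm u)\<^sup>2)"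
    unfolding power2_norm_eq_inner by (simp add: algebra_simps inner_commute)
  also have "\<dots> \<le> (norm (y - x))\<^sup>2"
  proof -
    have "s * r \<le> s * ((y - x) \<bullet> u)" using le s(1) by (rule mult_left_mono)
    moreover have "0 \<le> s * ((y - x) \<bullet> u)" using le s(1) r by simp
    ultimately show ?thesis using s(2) by simp
  qed
  finally show ?thesis by (simp add: dist_norm power2_le_iff_abs_le)
qed

text \<open>The distance bound maps points within \<open>e\<close> of \<open>x\<close> into the
  \<open>e\<close>-ball around \<open>x\<close>. This covers interior and boundary points of the
  level set alike.\<close>

lemma subgrad_projector_continuous_at_lev:
  fixes f :: "'a::real_inner \<Rightarrow> ereal"
  assumes "proper_fun f" and x: "x \<in> lev_le0 f"
  shows "setval_continuous_at (subgrad_projector f) x"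
proof (rule setval_continuous_at_singletonI)
  show "subgrad_projector f x = {x}"
    using x by (simp add: subgrad_projector_def lev_le0_def)
  fix e :: real assume "e > 0"
  then have "\<forall>\<^sub>F y in nhds x. dist y x < e" by (auto simp: eventually_nhds_metric)
  then show "\<forall>\<^sub>F y in nhds x. subgrad_projector f y \<subseteq> ball x e"
  proof (rule eventually_mono)
    fix y assume "dist y x < e"
    then show "subgrad_projector f y \<subseteq> ball x e"
      using subgrad_projector_dist_le[OF assms(1), of x _ y] x
      by (force simp: lev_le0_def dist_commute)
  qed
qed

section \<open>Gradients and nearby subgradients\<close>

text \<open>By convexity the difference quotients from \<open>x\<close> towards \<open>z\<close> are
  at most \<open>F z - F x\<close> for \<open>0 < t < 1\<close>; letting \<open>t\<close> decrease
  to 0 yields the subgradient inequality.\<close>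

lemma gradient_in_subdifferential:
  fixes f :: "'a::real_inner \<Rightarrow> ereal"
  assumes "proper_fun f" "convex_fun f" and fx: "f x < \<infinity>"
    and der: "((\<lambda>y. real_of_ereal (f y)) has_derivative (\<lambda>h. h \<bullet> u)) (at x)"
  shows "u \<in> subdifferential f x"
  unfolding subdifferential_def
proof (intro CollectI allI)
  fix z
  define F where "F = (\<lambda>y. real_of_ereal (f y))"
  have fin: "f y = ereal (F y)" if "f y < \<infinity>" for y
    using assms(1) that by (cases "f y") (auto simp: F_def proper_fun_def)
  show "f x + ereal ((z - x) \<bullet> u) \<le> f z"
  proof (cases "f z < \<infinity>")
    case True
    have "(z - x) \<bullet> u \<le> F z - F x"
    proof (rule tendsto_upperbound)
      let ?g = "\<lambda>t. (F (x + t *\<^sub>R (z - x)) - F x) / t"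
      have "((\<lambda>t. F (x + t *\<^sub>R (z - x))) has_derivative (\<lambda>t. (t *\<^sub>R (z - x)) \<bullet> u)) (at 0)"
        by (rule has_derivative_compose[of "\<lambda>t. x + t *\<^sub>R (z - x)" _ 0 UNIV F, simplified])
          (auto intro!: derivative_eq_intros simp: der[folded F_def])
      then have "((\<lambda>t. F (x + t *\<^sub>R (z - x))) has_field_derivative (z - x) \<bullet> u) (at 0)"
        by (simp add: has_field_derivative_def mult_commute_abs)
      then have "(?g \<longlongrightarrow> (z - x) \<bullet> u) (at 0)"
        by (simp add: has_field_derivative_iff)
      then show "(?g \<longlongrightarrow> (z - x) \<bullet> u) (at_right 0)"
        by (rule tendsto_mono[rotated]) (simp add: at_le)
      have "?g t \<le> F z - F x" if "t \<in> {0<..<1}" for t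
      proof -
        have "x + t *\<^sub>R (z - x) = (1 - t) *\<^sub>R x + t *\<^sub>R z" by (simp add: algebra_simps)
        then have "f (x + t *\<^sub>R (z - x)) \<le> ereal (1 - t) * f x + ereal t * f z"
          using assms(2) that by (simp add: convex_fun_def)
        also have "\<dots> = ereal ((1 - t) * F x + t * F z)"
          using fin[OF fx] fin[OF True] by simp
        finally have le: "f (x + t *\<^sub>R (z - x)) \<le> ereal ((1 - t) * F x + t * F z)" .
        then have "f (x + t *\<^sub>R (z - x)) = ereal (F (x + t *\<^sub>R (z - x)))"
          by (intro fin) (auto intro: le_less_trans)
        with le have "F (x + t *\<^sub>R (z - x)) \<le> (1 - t) * F x + t * F z"
          by simp
        then have "F (x + t *\<^sub>R (z - x)) - F x \<le> (F z - F x) * t" by (simp add: algebra_simps)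
          then show ?thesis using that by (simp add: pos_divide_le_eq)
      qed
      then show "\<forall>\<^sub>F t in at_right 0. ?g t \<le> F z - F x"
        by (auto simp: eventually_at_right[of 0 1] intro!: exI[of _ 1])
    qed simp
    then show ?thesis by (simp add: fin[OF fx] fin[OF True])
  qed (simp add: not_less)
qed

text \<open>A subgradient \<open>v\<close> at \<open>y\<close> is tested at \<open>x + h\<close>,
  with \<open>h\<close> of fixed length \<open>d\<close> in the direction of \<open>v - u\<close>.
  The first-order expansion at \<open>x\<close> bounds \<open>f\<close> there uniformly in the
  direction, which is where the Frechet property enters.\<close>

lemma subdifferential_near_gradient:
  fixes f :: "'a::real_inner \<Rightarrow> ereal"
  assumes "proper_fun f" and x: "x \<in> interior (effective_dom f)"
    and der: "((\<lambda>y. real_of_ereal (f y)) has_derivative (\<lambda>h. h \<bullet> u)) (at x)"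
    and e: "e > 0"
  shows "\<forall>\<^sub>F y in nhds x. \<forall>v \<in> subdifferential f y. norm (v - u) < e"
proof -
  define F where "F = (\<lambda>y. real_of_ereal (f y))"
  have fin: "f y = ereal (F y)" if "y \<in> effective_dom f" for y
    using assms(1) that by (cases "f y") (auto simp: F_def proper_fun_def effective_dom_def)
  have der: "(F has_derivative (\<lambda>h. h \<bullet> u)) (at x)" using der by (simp add: F_def)
  obtain d1 where d1: "d1 > 0"
    "\<And>y. norm (y - x) < d1 \<Longrightarrow> norm (F y - F x - (y - x) \<bullet> u) \<le> e / 8 * norm (y - x)"
    using der e unfolding has_derivative_at_alt by (meson divide_pos_pos zero_less_numeral)
  obtain d2 where d2: "d2 > 0" "ball x d2 \<subseteq> effective_dom f"
    using x by (auto simp: mem_interior)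
  \<comment> \<open>The halving keeps points at distance exactly \<open>d\<close> from
    \<open>x\<close>, such as \<open>x + h\<close>, strictly inside both balls.\<close>
  define d where "d = min d1 d2 / 2"
  have d: "d > 0" "d < d1" "d < d2" using d1(1) d2(1) by (auto simp: d_def)
  have near: "y \<in> effective_dom f" "F y \<le> F x + (y - x) \<bullet> u + e / 8 * norm (y - x)"
    if "norm (y - x) \<le> d" for y
  proof -
    show "y \<in> effective_dom f"
      using d2(2) d that by (force simp: dist_norm norm_minus_commute)
    have "norm (y - x) < d1" using that d by simp
    from d1(2)[OF this] show "F y \<le> F x + (y - x) \<bullet> u + e / 8 * norm (y - x)"
      unfolding real_norm_def by linarith
  qed
  have cont: "isCont F x" using der by (rule has_derivative_continuous)
  \<comment> \<open>This expression bounds the error, apart from the term in \<open>v - u\<close>,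
    of basing the subgradient inequality at \<open>y\<close> instead of \<open>x\<close>.\<close>
  have "((\<lambda>y. \<bar>F x - F y\<bar> + norm (x - y) * norm u) \<longlongrightarrow>
      \<bar>F x - F x\<bar> + norm (x - x) * norm u) (nhds x)"
    by (intro tendsto_intros cont[unfolded isCont_def tendsto_at_iff_tendsto_nhds] filterlim_ident)
  then have "((\<lambda>y. \<bar>F x - F y\<bar> + norm (x - y) * norm u) \<longlongrightarrow> 0) (nhds x)" by simp
  from order_tendstoD(2)[OF this, of "e * d / 8"] e d(1)
  have "\<forall>\<^sub>F y in nhds x. \<bar>F x - F y\<bar> + norm (x - y) * norm u < e * d / 8" by simp
  \<comment> \<open>With this radius \<open>(x - y) \<bullet> w\<close> costs at most half of
    \<open>d * norm w\<close>, which the left side of the final estimate absorbs.\<close>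
  moreover have "\<forall>\<^sub>F y in nhds x. dist y x < d / 2"
    using d(1) by (auto simp: eventually_nhds_metric intro!: exI[of _ "d / 2"])
  ultimately show ?thesis
  proof eventually_elim
    case (elim y)
    show ?case
    proof
      fix v assume v: "v \<in> subdifferential f y"
      define w where "w = v - u"
      show "norm (v - u) < e"
      proof (cases "w = 0")
        case False
        \<comment> \<open>This is the equality case of Cauchy-Schwarz: \<open>h \<bullet> w\<close>
          attains \<open>d * norm w\<close>.\<close>
        define h where "h = (d / norm w) *\<^sub>R w"
        have nh: "norm h = d" using False d(1) by (simp add: h_def)
        have hw: "h \<bullet> w = d * norm w"
          using False by (simp add: h_def power2_norm_eq_inner[symmetric] power2_eq_square)
        have fy: "f y = ereal (F y)"
          using elim d(1) by (intro fin near(1)) (simp add: dist_norm)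
        have fh: "f (x + h) = ereal (F (x + h))" by (intro fin near(1)) (simp add: nh)
        have "f y + ereal ((x + h - y) \<bullet> v) \<le> f (x + h)"
          using v by (simp add: subdifferential_def)
        then have "F y + (x + h - y) \<bullet> v \<le> F (x + h)" by (simp add: fy fh)
        also have "\<dots> \<le> F x + h \<bullet> u + e / 8 * d" using near(2)[of "x + h"] nh by simp
        finally have "F y + (x - y) \<bullet> v + h \<bullet> v \<le> F x + h \<bullet> u + e / 8 * d"
          by (simp add: inner_add_left inner_diff_left)
        then have "h \<bullet> w \<le> F x - F y - (x - y) \<bullet> u - (x - y) \<bullet> w + e / 8 * d"
          unfolding w_def by (simp add: inner_diff_right)
        moreover have "- ((x - y) \<bullet> u) \<le> norm (x - y) * norm u"
          using Cauchy_Schwarz_ineq2[of "x - y" u] by simp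
        moreover have "- ((x - y) \<bullet> w) \<le> norm (x - y) * norm w"
          using Cauchy_Schwarz_ineq2[of "x - y" w] by simp
        moreover have "norm (x - y) * norm w \<le> d / 2 * norm w"
          using elim by (intro mult_right_mono) (auto simp: dist_norm norm_minus_commute)
        \<comment> \<open>The term \<open>e * d / 4\<close> collects \<open>e * d / 8\<close> from
          the expansion at \<open>x\<close> and \<open>e * d / 8\<close> from the change of base
          point.\<close>
        ultimately have "d * norm w \<le> d / 2 * norm w + e * d / 4"
          using hw elim(1) abs_ge_self[of "F x - F y"] by argo
        then have "d * norm w \<le> d * (e / 2)" by argo
        then have "norm w \<le> e / 2" using d(1) by simp
        then show ?thesis using e by (simp add: w_def)
      qed (use e in \<open>simp add: w_def\<close>)
    qed
  qed
qed

section \<open>Continuity where \<open>f\<close> is positive, and the conclusion\<close>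

lemma subgrad_projector_continuous_at_differentiable:
  fixes f :: "'a::{real_inner,complete_space} \<Rightarrow> ereal"
  assumes "proper_fun f" "convex_fun f" and lev: "lev_le0 f \<noteq> {}"
    and x: "x \<in> interior (effective_dom f)" "f x > 0"
    and diff: "(\<lambda>y. real_of_ereal (f y)) differentiable (at x)"
  shows "setval_continuous_at (subgrad_projector f) x"
proof -
  define F where "F = (\<lambda>y. real_of_ereal (f y))"
  obtain D where D: "(F has_derivative D) (at x)"
    using diff by (auto simp: differentiable_def F_def)
  obtain u where u: "\<And>h. D h = h \<bullet> u"
    using riesz_representation[OF has_derivative_bounded_linear[OF D]] by blast
  have "D = (\<lambda>h. h \<bullet> u)" using u by (rule ext)
  with D have der: "(F has_derivative (\<lambda>h. h \<bullet> u)) (at x)" by simp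
  have fx: "f x < \<infinity>" using x(1) interior_subset by (force simp: effective_dom_def)
  have u_in: "u \<in> subdifferential f x"
    using gradient_in_subdifferential[OF assms(1,2) fx] der unfolding F_def by blast
  have close: "\<forall>\<^sub>F y in nhds x. \<forall>v \<in> subdifferential f y. norm (v - u) < e" if "e > 0" for e
    using subdifferential_near_gradient[OF assms(1) x(1) _ that] der unfolding F_def by blast
  \<comment> \<open>The neighborhood estimate holds at \<open>x\<close> itself, so the tolerance
    \<open>norm (v - u)\<close> is contradictory.\<close>
  have "v = u" if "v \<in> subdifferential f x" for v
  proof (rule ccontr)
    assume "v \<noteq> u"
    then show False
      using eventually_nhds_x_imp_x[OF close[of "norm (v - u)"]] that by auto
  qed
  then have sub_x: "subdifferential f x = {u}" using u_in by blast
  \<comment> \<open>A zero subgradient would make \<open>x\<close> a global minimizer, although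
    \<open>f\<close> takes a nonpositive value and \<open>f x\<close> is positive.\<close>
  have "u \<noteq> 0"
  proof
    assume "u = 0"
    obtain z where "f z \<le> 0" using lev by (auto simp: lev_le0_def)
    moreover have "f x \<le> f z" using u_in \<open>u = 0\<close> by (auto simp: subdifferential_def)
    ultimately show False using x(2) by auto
  qed
  \<comment> \<open>Treating point, value and subgradient as independent arguments reduces the
    estimate to continuity of \<open>g\<close> at one triple, where the denominator is
    nonzero.\<close>
  define g :: "'a \<times> real \<times> 'a \<Rightarrow> 'a"
    where "g = (\<lambda>(y, r, v). y - (r / (norm v)\<^sup>2) *\<^sub>R v)"
  have proj: "subgrad_projector f y =
      (if f y \<le> 0 then {y} else {g (y, F y, v) | v. v \<in> subdifferential f y})" for y
    by (simp add: subgrad_projector_def g_def F_def)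
  show ?thesis
  proof (rule setval_continuous_at_singletonI)
    show "subgrad_projector f x = {g (x, F x, u)}"
      using x(2) sub_x by (auto simp: proj)
    fix e :: real assume "e > 0"
    have "isCont g (x, F x, u)"
      unfolding g_def split_beta by (intro continuous_intros) (simp add: \<open>u \<noteq> 0\<close>)
    then have "(g \<longlongrightarrow> g (x, F x, u)) (nhds (x, F x, u))"
      by (simp add: isCont_def tendsto_at_iff_tendsto_nhds)
    from tendstoD[OF this \<open>e > 0\<close>]
    obtain P Q R where PQR: "eventually P (nhds x)" "eventually Q (nhds (F x))" "eventually R (nhds u)"
      and dist_g: "\<And>y r v. P y \<Longrightarrow> Q r \<Longrightarrow> R v \<Longrightarrow> dist (g (y, r, v)) (g (x, F x, u)) < e"
      unfolding nhds_prod eventually_prod_filter by metis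
    obtain r where r: "r > 0" "\<And>v. dist v u < r \<Longrightarrow> R v"
      using PQR(3) by (auto simp: eventually_nhds_metric)
    have "(F \<longlongrightarrow> F x) (nhds x)"
      using has_derivative_continuous[OF der] by (simp add: isCont_def tendsto_at_iff_tendsto_nhds)
    moreover have "F x > 0" using x(2) fx by (cases "f x") (auto simp: F_def)
    ultimately have "\<forall>\<^sub>F y in nhds x. Q (F y)" "\<forall>\<^sub>F y in nhds x. F y > 0"
      using PQR(2) by (simp add: filterlim_iff, blast intro: order_tendstoD(1))
    then show "\<forall>\<^sub>F y in nhds x. subgrad_projector f y \<subseteq> ball (g (x, F x, u)) e"
      using PQR(1) close[OF r(1)]
    proof eventually_elim
      case (elim y)
      \<comment> \<open>Since \<open>real_of_ereal\<close> is 0 at both infinities,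
        \<open>F y > 0\<close> forces \<open>f y\<close> to be finite and positive.\<close>
      have "\<not> f y \<le> 0"
        using elim(2) by (cases "f y") (auto simp: F_def)
      moreover have "dist (g (x, F x, u)) (g (y, F y, v)) < e" if "v \<in> subdifferential f y" for v
      proof -
        have "dist v u < r" using elim(4) that by (simp add: dist_norm)
        then show ?thesis using dist_g[OF elim(3,1) r(2)] by (simp add: dist_commute)
      qed
      ultimately show ?case by (auto simp: proj)
    qed
  qed
qed

theorem proposition5p13:
  fixes f :: "'a::{real_inner,complete_space} \<Rightarrow> ereal"
  assumes "f \<in> Gamma0"
    and "lev_le0 f \<noteq> {}"
    and "\<forall>x \<in> interior (effective_dom f) \<inter> {x. f x > 0}.
           (\<lambda>y. real_of_ereal (f y)) differentiable (at x)"
  shows "(\<forall>x \<in> interior (lev_le0 f) \<union> (interior (effective_dom f) \<inter> {x. f x > 0}).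
            setval_continuous_at (subgrad_projector f) x) \<and>
         (\<forall>x \<in> frontier (lev_le0 f). setval_lsc_at (subgrad_projector f) x)"
proof -
  have f: "proper_fun f" "convex_fun f" "lsc_fun f"
    using assms(1) by (auto simp: Gamma0_def)
  \<comment> \<open>Closedness, hence lower semicontinuity of \<open>f\<close>, places boundary
    points in the level set, where continuity is already established.\<close>
  have "frontier (lev_le0 f) \<subseteq> lev_le0 f"
    using closed_lev_le0[OF f(3)] by (simp add: frontier_subset_closed)
  then show ?thesis
    using subgrad_projector_continuous_at_lev[OF f(1)] interior_subset[of "lev_le0 f"]
      subgrad_projector_continuous_at_differentiable[OF f(1,2) assms(2)] assms(3)
    by (auto simp: setval_continuous_at_def)
qed

end
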